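(* Let $\mathcal{R}$ be a $2$-torsion free commutative ring with identity and let $(X,\leqslant)$ be a locally finite pre-ordered set. Then every Jordan derivation of the incidence algebra $I(X,\mathcal{R})$ is a derivation.
   Context: A pre-ordered set $(X,\leqslant)$ is a set with a reflexive and transitive binary relation $\leqslant$; it is locally finite if for all $x\leqslant y$ in $X$ there are only finitely many $z\in X$ with $x\leqslant z\leqslant y$. The incidence algebra $I(X,\mathcal{R})$ is the $\mathcal{R}$-algebra of all functions $f:X\times X\to\mathcal{R}$ with $f(x,y)=0$ whenever $x\not\leqslant y$, with pointwise addition and scalar multiplication and with product (convolution) $(fg)(x,y)=\sum_{x\leqslant z\leqslant y}f(x,z)g(z,y)$ (for $x\leqslant y$). $\mathcal{R}$ is $2$-torsion free if $2r=0$ implies $r=0$ for $r\in\mathcal{R}$. For an $\mathcal{R}$-algebra $A$, a derivation is an $\mathcal{R}$-linear mapping $D:A\to A$ with $D(ab)=D(a)b+aD(b)$ for all $a,b\in A$; a Jordan derivation is an $\mathcal{R}$-linear mapping $D:A\to A$ with $D(a^2)=D(a)a+aD(a)$ for all $a\in A$. *)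

theory Defs
  imports Main "HOL-Library.FuncSet" "HOL-Library.Function_Algebras"
begin

text \<open>
  A pre-ordered set is a carrier \<open>X\<close> with a relation \<open>r\<close> such that \<^term>\<open>preorder_on X r\<close>, which
  includes \<^term>\<open>r \<subseteq> X \<times> X\<close>; \<open>(x, y) \<in> r\<close> stands for \<open>x \<le> y\<close>.
\<close>

definition locally_finite :: "'x rel \<Rightarrow> bool" where
  "locally_finite r \<longleftrightarrow> (\<forall>(x, y) \<in> r. finite {z. (x, z) \<in> r \<and> (z, y) \<in> r})"

text \<open>
  A function on \<open>X \<times> X\<close> is represented by its extension by zero to the whole type, so the support
  condition below also fixes the (irrelevant) values outside \<open>X \<times> X\<close>. Addition in the incidence
  algebra is the pointwise \<open>+\<close> of \<^theory>\<open>HOL-Library.Function_Algebras\<close>; the pointwise \<open>*\<close> of that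
  theory is not its product.

  The class \<open>comm_ring_1\<close> demands \<open>0 \<noteq> 1\<close>. The sort \<open>{comm_ring, comm_monoid_mult}\<close>
  describes commutative rings with identity, the zero ring included.
\<close>

definition incidence_algebra :: "'x rel \<Rightarrow> ('x \<Rightarrow> 'x \<Rightarrow> 'r::{comm_ring, comm_monoid_mult}) set" where
  "incidence_algebra r = {f. \<forall>x y. (x, y) \<notin> r \<longrightarrow> f x y = 0}"

definition convolution ::
  "'x rel \<Rightarrow> ('x \<Rightarrow> 'x \<Rightarrow> 'r) \<Rightarrow> ('x \<Rightarrow> 'x \<Rightarrow> 'r) \<Rightarrow> ('x \<Rightarrow> 'x \<Rightarrow> 'r::{comm_ring, comm_monoid_mult})" where
  "convolution r f g =
     (\<lambda>x y. if (x, y) \<in> r then \<Sum>z \<in> {z. (x, z) \<in> r \<and> (z, y) \<in> r}. f x z * g z y else 0)"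

definition scale_pointwise ::
  "'r \<Rightarrow> ('x \<Rightarrow> 'x \<Rightarrow> 'r) \<Rightarrow> ('x \<Rightarrow> 'x \<Rightarrow> 'r::{comm_ring, comm_monoid_mult})" where
  "scale_pointwise c f = (\<lambda>x y. c * f x y)"

text \<open>
  Algebras are given by a carrier \<open>A\<close>, a scalar multiplication \<open>scl\<close> and a product \<open>mul\<close>;
  addition is that of the ambient type. A map is only constrained on \<open>A\<close>.
\<close>

definition linear_endo :: "('r \<Rightarrow> 'b \<Rightarrow> 'b) \<Rightarrow> 'b::ab_group_add set \<Rightarrow> ('b \<Rightarrow> 'b) \<Rightarrow> bool" where
  "linear_endo scl A D \<longleftrightarrow>
     D \<in> A \<rightarrow> A \<and>
     (\<forall>a\<in>A. \<forall>b\<in>A. D (a + b) = D a + D b) \<and>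
     (\<forall>c. \<forall>a\<in>A. D (scl c a) = scl c (D a))"

definition derivation ::
  "('r \<Rightarrow> 'b \<Rightarrow> 'b) \<Rightarrow> ('b \<Rightarrow> 'b \<Rightarrow> 'b) \<Rightarrow> 'b::ab_group_add set \<Rightarrow> ('b \<Rightarrow> 'b) \<Rightarrow> bool" where
  "derivation scl mul A D \<longleftrightarrow>
     linear_endo scl A D \<and> (\<forall>a\<in>A. \<forall>b\<in>A. D (mul a b) = mul (D a) b + mul a (D b))"

definition jordan_derivation ::
  "('r \<Rightarrow> 'b \<Rightarrow> 'b) \<Rightarrow> ('b \<Rightarrow> 'b \<Rightarrow> 'b) \<Rightarrow> 'b::ab_group_add set \<Rightarrow> ('b \<Rightarrow> 'b) \<Rightarrow> bool" where
  "jordan_derivation scl mul A D \<longleftrightarrow>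
     linear_endo scl A D \<and> (\<forall>a\<in>A. D (mul a a) = mul (D a) a + mul a (D a))"

lemma incidence_algebra_closed:
  assumes "f \<in> incidence_algebra r" "g \<in> incidence_algebra r"
  shows "f + g \<in> incidence_algebra r" "scale_pointwise c f \<in> incidence_algebra r"
    "convolution r f g \<in> incidence_algebra r"
  using assms by (auto simp: incidence_algebra_def scale_pointwise_def convolution_def)

end

theory Submission
  imports Defs
begin

text \<open>
  Write \<open>E x y\<close> for the matrix units, and let \<open>D\<close> be a Jordan derivation. The idea is to compute \<open>D\<close>
  explicitly, one entry at a time, by compressing with the idempotents \<open>E x x\<close>.

  As in every \<open>2\<close>-torsion free algebra, the Jordan identity linearizes to formulas for
  \<open>D (ab + ba)\<close>, \<open>D (aba)\<close> and \<open>D (abc + cba)\<close>. Applied with \<open>a = E x x\<close> and \<open>c = E y y\<close>, the last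
  one expresses the entry \<open>D f x y\<close> of an arbitrary \<open>f\<close> through \<open>D\<close> on matrix units. This matters
  because \<open>D\<close> is not assumed to be compatible with infinite sums, so its values on matrix units do
  not determine it a priori. The outcome (lemma \<open>decomposition\<close>) is that \<open>D\<close> sends \<open>f\<close> to the sum of
  the entrywise product of \<open>c\<close> with \<open>f\<close> and the commutator \<open>f d - d f\<close>, where
  \<open>c x y = D (E x y) x y\<close> and \<open>d x z = D (E x x) x z\<close>.

  The part \<open>f d - d f\<close> is an inner derivation. Entrywise multiplication by \<open>c\<close> is a derivation as
  soon as \<open>c\<close> is additive, \<open>c x y = c x z + c z y\<close> for \<open>x \<le> z \<le> y\<close> (lemma \<open>c_additive\<close>). This
  follows from \<open>E x y = E x z E z y + E z y E x z\<close> when \<open>x, y, z\<close> are distinct. In the one remaining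
  nontrivial case \<open>x = y\<close> it follows from \<open>E x z = E x z E z x E x z\<close>.
\<close>

section \<open>Jordan derivations of associative algebras\<close>

text \<open>
  The product is associative and biadditive on the whole ambient group, because the convolution of
  arbitrary functions is so; only \<open>D\<close> has to be confined to the carrier \<open>A\<close>.
\<close>

locale jordan_map =
  fixes mul :: "'b::ab_group_add \<Rightarrow> 'b \<Rightarrow> 'b" (infixl "\<star>" 70)
    and A :: "'b set"
    and D :: "'b \<Rightarrow> 'b"
  assumes assoc: "(a \<star> b) \<star> c = a \<star> (b \<star> c)"
    and distrib_right: "(a + b) \<star> c = a \<star> c + b \<star> c"
    and distrib_left: "a \<star> (b + c) = a \<star> b + a \<star> c"
    and add_closed: "a \<in> A \<Longrightarrow> b \<in> A \<Longrightarrow> a + b \<in> A"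
    and mul_closed: "a \<in> A \<Longrightarrow> b \<in> A \<Longrightarrow> a \<star> b \<in> A"
    and D_add: "a \<in> A \<Longrightarrow> b \<in> A \<Longrightarrow> D (a + b) = D a + D b"
    and D_square: "a \<in> A \<Longrightarrow> D (a \<star> a) = D a \<star> a + a \<star> D a"
    and double_eq_0: "a + a = 0 \<Longrightarrow> a = (0::'b)"
begin

lemma D_jordan_product:
  assumes "a \<in> A" "b \<in> A"
  shows "D (a \<star> b + b \<star> a) = D a \<star> b + a \<star> D b + D b \<star> a + b \<star> D a"
proof -
  have "D ((a + b) \<star> (a + b)) = D (a \<star> a) + D (b \<star> b) + D (a \<star> b + b \<star> a)"
    using assms by (simp add: distrib_left distrib_right D_add add_closed mul_closed algebra_simps)
  then show ?thesis
    using assms D_square[of "a + b"]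
    by (simp add: D_square D_add add_closed distrib_left distrib_right algebra_simps)
qed

text \<open>
  Twice \<open>aba\<close> is a combination of Jordan products, \<open>a(ab + ba) + (ab + ba)a - (aab + baa)\<close>;
  this is the only use of the absence of \<open>2\<close>-torsion.
\<close>

lemma D_triple:
  assumes a: "a \<in> A" and b: "b \<in> A"
  shows "D (a \<star> b \<star> a) = D a \<star> b \<star> a + a \<star> D b \<star> a + a \<star> b \<star> D a"
proof -
  let ?j = "a \<star> b + b \<star> a" and ?t = "a \<star> b \<star> a"
  let ?R = "D a \<star> b \<star> a + a \<star> D b \<star> a + a \<star> b \<star> D a"
  have j: "?j \<in> A" and t: "?t \<in> A" and aa: "a \<star> a \<in> A"
    using a b by (simp_all add: add_closed mul_closed)
  have "a \<star> ?j + ?j \<star> a = (?t + ?t) + (a \<star> a \<star> b + b \<star> (a \<star> a))"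
    by (simp add: distrib_left distrib_right assoc algebra_simps)
  then have "D (a \<star> ?j + ?j \<star> a) = D ?t + D ?t + D (a \<star> a \<star> b + b \<star> (a \<star> a))"
    using t aa b by (simp add: D_add add_closed mul_closed)
  then have "D ?t + D ?t = ?R + ?R"
    unfolding D_jordan_product[OF a j] D_jordan_product[OF a b] D_jordan_product[OF aa b]
      D_square[OF a]
    by (simp add: distrib_left distrib_right assoc algebra_simps)
  then have "(D ?t - ?R) + (D ?t - ?R) = 0"
    by (simp add: algebra_simps)
  then have "D ?t - ?R = 0"
    by (rule double_eq_0)
  then show ?thesis
    by simp
qed

lemma D_triple_linearized:
  assumes "a \<in> A" "b \<in> A" "c \<in> A"
  shows "D (a \<star> b \<star> c + c \<star> b \<star> a) =
    D a \<star> b \<star> c + a \<star> D b \<star> c + a \<star> b \<star> D c + D c \<star> b \<star> a + c \<star> D b \<star> a + c \<star> b \<star> D a"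
proof -
  have "D ((a + c) \<star> b \<star> (a + c)) =
      D (a \<star> b \<star> a) + D (c \<star> b \<star> c) + D (a \<star> b \<star> c + c \<star> b \<star> a)"
    using assms by (simp add: distrib_left distrib_right D_add add_closed mul_closed algebra_simps)
  then show ?thesis
    using assms D_triple[of "a + c" b]
    by (simp add: D_triple D_add add_closed distrib_left distrib_right algebra_simps)
qed

end

section \<open>Convolution and matrix units\<close>

lemma convolution_distrib:
  "convolution r (f + g) h = convolution r f h + convolution r g h"
  "convolution r f (g + h) = convolution r f g + convolution r f h"
  by (auto simp: convolution_def fun_eq_iff algebra_simps sum.distrib)

lemma convolution_diff:
  "convolution r (f - g) h = convolution r f h - convolution r g h"
  "convolution r f (g - h) = convolution r f g - convolution r f h"
  by (auto simp: convolution_def fun_eq_iff algebra_simps sum_subtractf)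

text \<open>Both sides are the sum over all chains \<open>x \<le> z \<le> w \<le> y\<close>.\<close>

lemma convolution_assoc:
  assumes "trans r" and "locally_finite r"
  shows "convolution r (convolution r f g) h = convolution r f (convolution r g h)"
proof (intro ext)
  fix x y
  let ?I = "\<lambda>x y. {z. (x, z) \<in> r \<and> (z, y) \<in> r}"
  show "convolution r (convolution r f g) h x y = convolution r f (convolution r g h) x y"
  proof (cases "(x, y) \<in> r")
    case xy: True
    have fin: "finite (?I u v)" if "(u, v) \<in> r" for u v
      using assms(2) that by (auto simp: locally_finite_def)
    have "convolution r (convolution r f g) h x y =
        (\<Sum>w\<in>?I x y. \<Sum>z\<in>?I x w. f x z * g z w * h w y)"
      using xy by (auto simp: convolution_def sum_distrib_right intro!: sum.cong)
    also have "\<dots> = (\<Sum>(w, z)\<in>(SIGMA w:?I x y. ?I x w). f x z * g z w * h w y)"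
      using fin xy by (subst sum.Sigma) auto
    also have "\<dots> = (\<Sum>(z, w)\<in>(SIGMA z:?I x y. ?I z y). f x z * g z w * h w y)"
      by (rule sum.reindex_bij_witness[of _ prod.swap prod.swap])
        (auto, (meson transD[OF assms(1)])+)
    also have "\<dots> = (\<Sum>z\<in>?I x y. \<Sum>w\<in>?I z y. f x z * g z w * h w y)"
      using fin xy by (subst sum.Sigma) auto
    also have "\<dots> = convolution r f (convolution r g h) x y"
      using xy by (auto simp: convolution_def sum_distrib_left mult.assoc intro!: sum.cong)
    finally show ?thesis .
  qed (simp add: convolution_def)
qed

definition matrix_unit :: "'x \<Rightarrow> 'x \<Rightarrow> 'x \<Rightarrow> 'x \<Rightarrow> 'r::{comm_ring, comm_monoid_mult}" where
  "matrix_unit a b = (\<lambda>u v. if u = a \<and> v = b then 1 else 0)"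

lemma matrix_unit_in_incidence_algebra:
  "(a, b) \<in> r \<Longrightarrow> matrix_unit a b \<in> incidence_algebra r"
  by (auto simp: incidence_algebra_def matrix_unit_def)

lemma convolution_matrix_unit_right:
  assumes "trans r" "locally_finite r" "(a, b) \<in> r" "f \<in> incidence_algebra r"
  shows "convolution r f (matrix_unit a b) x y = (if y = b then f x a else 0)"
proof (cases "(x, y) \<in> r")
  case True
  then have "finite {z. (x, z) \<in> r \<and> (z, y) \<in> r}"
    using assms(2) by (auto simp: locally_finite_def)
  moreover have "f x z * matrix_unit a b z y = (if z = a then if y = b then f x a else 0 else 0)" for z
    by (simp add: matrix_unit_def)
  ultimately show ?thesis
    using True assms by (auto simp: convolution_def incidence_algebra_def)
next
  case False
  then show ?thesis
    using assms by (auto simp: convolution_def incidence_algebra_def dest: transD)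
qed

lemma convolution_matrix_unit_left:
  assumes "trans r" "locally_finite r" "(a, b) \<in> r" "f \<in> incidence_algebra r"
  shows "convolution r (matrix_unit a b) f x y = (if x = a then f b y else 0)"
proof (cases "(x, y) \<in> r")
  case True
  then have "finite {z. (x, z) \<in> r \<and> (z, y) \<in> r}"
    using assms(2) by (auto simp: locally_finite_def)
  moreover have "matrix_unit a b x z * f z y = (if z = b then if x = a then f b y else 0 else 0)" for z
    by (simp add: matrix_unit_def)
  ultimately show ?thesis
    using True assms by (auto simp: convolution_def incidence_algebra_def)
next
  case False
  then show ?thesis
    using assms by (auto simp: convolution_def incidence_algebra_def dest: transD)
qed

text \<open>
  Additivity of \<open>c\<close> is what makes each summand of \<open>(f g) x y\<close> split as required by the product rule.
\<close>

lemma entrywise_multiplication_product_rule: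
  assumes "\<And>x z y. (x, z) \<in> r \<Longrightarrow> (z, y) \<in> r \<Longrightarrow> c x y = c x z + c z y"
  shows "(\<lambda>x y. c x y * convolution r f g x y) =
    convolution r (\<lambda>x y. c x y * f x y) g + convolution r f (\<lambda>x y. c x y * g x y)"
proof (intro ext)
  fix x y
  have "c x y * (f x z * g z y) = c x z * f x z * g z y + f x z * (c z y * g z y)"
    if "(x, z) \<in> r" "(z, y) \<in> r" for z
    using assms[OF that] by (simp add: algebra_simps)
  then show "c x y * convolution r f g x y =
    (convolution r (\<lambda>x y. c x y * f x y) g + convolution r f (\<lambda>x y. c x y * g x y)) x y"
    by (auto simp: convolution_def sum_distrib_left sum.distrib[symmetric] intro!: sum.cong)
qed

section \<open>Entries of a Jordan derivation\<close>

locale incidence_jordan =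
  fixes X :: "'x set" and r :: "'x rel"
    and D :: "('x \<Rightarrow> 'x \<Rightarrow> 'r::{comm_ring, comm_monoid_mult}) \<Rightarrow> ('x \<Rightarrow> 'x \<Rightarrow> 'r)"
  assumes torsion: "\<And>s::'r. s + s = 0 \<Longrightarrow> s = 0"
    and preorder: "preorder_on X r"
    and loc_fin: "locally_finite r"
    and jordan: "jordan_derivation scale_pointwise (convolution r) (incidence_algebra r) D"
begin

abbreviation conv :: "('x \<Rightarrow> 'x \<Rightarrow> 'r) \<Rightarrow> ('x \<Rightarrow> 'x \<Rightarrow> 'r) \<Rightarrow> 'x \<Rightarrow> 'x \<Rightarrow> 'r" (infixl "\<star>" 70)
  where "f \<star> g \<equiv> convolution r f g"
abbreviation I :: "('x \<Rightarrow> 'x \<Rightarrow> 'r) set" where "I \<equiv> incidence_algebra r"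
abbreviation E :: "'x \<Rightarrow> 'x \<Rightarrow> 'x \<Rightarrow> 'x \<Rightarrow> 'r" where "E \<equiv> matrix_unit"

lemma trans_r: "trans r"
  using preorder by (simp add: preorder_on_def)

lemma refl_r: "(x, y) \<in> r \<Longrightarrow> (x, x) \<in> r \<and> (y, y) \<in> r"
  using preorder by (auto simp: preorder_on_def refl_on_def)

lemma D_closed: "f \<in> I \<Longrightarrow> D f \<in> I"
  using jordan by (auto simp: jordan_derivation_def linear_endo_def)

lemma D_scale: "f \<in> I \<Longrightarrow> D (scale_pointwise s f) x y = s * D f x y"
  using jordan by (simp add: jordan_derivation_def linear_endo_def scale_pointwise_def[of _ "D f"])

sublocale jordan_map "convolution r" I D
proof
  show "f = 0" if "f + f = 0" for f :: "'x \<Rightarrow> 'x \<Rightarrow> 'r"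
  proof (intro ext)
    show "f x y = 0 x y" for x y
      using torsion[of "f x y"] that by (simp add: fun_eq_iff)
  qed
qed (use jordan in \<open>simp_all add: convolution_assoc[OF trans_r loc_fin] convolution_distrib
      incidence_algebra_closed jordan_derivation_def linear_endo_def\<close>)

lemma D_zero: "D (\<lambda>x y. 0) = (\<lambda>x y. 0)"
  using D_scale[of "\<lambda>x y. 0" 0]
  by (simp add: fun_eq_iff scale_pointwise_def incidence_algebra_def)

lemmas unit_right = convolution_matrix_unit_right[OF trans_r loc_fin]
lemmas unit_left = convolution_matrix_unit_left[OF trans_r loc_fin]
lemmas closed = incidence_algebra_closed matrix_unit_in_incidence_algebra D_closed

lemma unit_left_of_product:
  assumes "(a, b) \<in> r" "f \<in> I" "g \<in> I"
  shows "(E a b \<star> f \<star> g) x y = (if x = a then (f \<star> g) b y else 0)"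
  using assms by (simp add: assoc unit_left closed)

lemmas entry_simps = unit_right unit_left unit_left_of_product closed

lemma matrix_unit_mult:
  assumes "(x, z) \<in> r" "(z, y) \<in> r"
  shows "E x z \<star> E z y = E x y"
  using assms by (auto simp: fun_eq_iff unit_right closed) (auto simp: matrix_unit_def)

lemma matrix_unit_mult_zero:
  assumes "(x, z) \<in> r" "(w, y) \<in> r" "z \<noteq> w"
  shows "E x z \<star> E w y = (\<lambda>_ _. 0)"
  using assms by (auto simp: fun_eq_iff unit_right closed) (auto simp: matrix_unit_def)

lemma compress:
  assumes "(x, x) \<in> r" "(y, y) \<in> r" "f \<in> I"
  shows "E x x \<star> f \<star> E y y = scale_pointwise (f x y) (E x y)"
  using assms by (auto simp: fun_eq_iff entry_simps scale_pointwise_def) (auto simp: matrix_unit_def)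

definition c :: "'x \<Rightarrow> 'x \<Rightarrow> 'r" where "c x y = D (E x y) x y"

definition d :: "'x \<Rightarrow> 'x \<Rightarrow> 'r" where "d x z = D (E x x) x z"

lemma c_diag:
  assumes "(x, x) \<in> r"
  shows "c x x = 0"
proof -
  have "D (E x x \<star> E x x) x x = c x x + c x x"
    using assms by (subst D_square) (auto simp: entry_simps c_def)
  then show ?thesis
    using assms by (simp add: matrix_unit_mult c_def)
qed

text \<open>
  Comparing entries in \<open>D (E x x E z z + E z z E x x) = 0\<close> shows that rows and columns of the
  values of \<open>D\<close> on idempotents carry the same information up to sign.
\<close>

lemma column_eq_neg_d:
  assumes "(z, y) \<in> r"
  shows "D (E y y) z y = - d z y"
proof (cases "z = y")
  case True
  then show ?thesis
    using c_diag[of y] refl_r[OF assms] by (simp add: c_def d_def)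
next
  case False
  have "D (E z z \<star> E y y + E y y \<star> E z z) z y = 0"
    using refl_r[OF assms] False by (simp add: matrix_unit_mult_zero D_zero plus_fun_def)
  then have "D (E z z) z y + D (E y y) z y = 0"
    using refl_r[OF assms] False by (subst (asm) D_jordan_product) (auto simp: entry_simps)
  then show ?thesis
    by (simp add: d_def eq_neg_iff_add_eq_0 add.commute)
qed

text \<open>
  Expand \<open>D\<close> on \<open>E y x = E y x E x y E y x\<close>. In each of the three summands at least one outer factor
  \<open>E y x\<close> survives, so the summand lives in row \<open>y\<close> or in column \<open>x\<close> and misses the entry \<open>(x, y)\<close>.
\<close>

lemma D_matrix_unit_transposed_entry:
  assumes "(x, y) \<in> r" "(y, x) \<in> r" "x \<noteq> y"
  shows "D (E y x) x y = 0"
proof -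
  have "D (E y x \<star> E x y \<star> E y x) x y = 0"
    using assms refl_r[OF assms(1)]
    by (subst D_triple) (auto simp: entry_simps assoc matrix_unit_mult)
  then show ?thesis
    using assms refl_r[OF assms(1)] by (simp add: matrix_unit_mult)
qed

lemma c_additive:
  assumes xz: "(x, z) \<in> r" and zy: "(z, y) \<in> r"
  shows "c x y = c x z + c z y"
proof -
  have xy: "(x, y) \<in> r"
    using trans_r xz zy by (rule transD)
  consider "z = x \<or> z = y" | "x = y" "z \<noteq> x" | "x \<noteq> y" "z \<noteq> x" "z \<noteq> y"
    by blast
  then show ?thesis
  proof cases
    case 1
    then show ?thesis
      using c_diag refl_r[OF xy] by auto
  next
    case 2
    have "D (E x z \<star> E z x \<star> E x z) x z = c x z + c z x + c x z"
      using 2 xz zy refl_r[OF xz] by (subst D_triple) (auto simp: entry_simps assoc matrix_unit_mult c_def)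
    then have "c x z + c z x = 0"
      using 2 xz zy refl_r[OF xz] by (simp add: matrix_unit_mult c_def)
    then show ?thesis
      using 2 c_diag refl_r[OF xz] by simp
  next
    case 3
    have "D (E x z \<star> E z y + E z y \<star> E x z) x y = c x z + c z y"
      using 3 xz zy refl_r[OF xy] by (subst D_jordan_product) (auto simp: entry_simps c_def)
    moreover have "E x z \<star> E z y + E z y \<star> E x z = E x y"
      using 3 xz zy by (simp add: matrix_unit_mult matrix_unit_mult_zero plus_fun_def)
    ultimately show ?thesis
      by (simp add: c_def)
  qed
qed

text \<open>
  Compress \<open>f\<close> by \<open>E x x\<close> and \<open>E y y\<close> and apply \<open>D\<close>: the term in which \<open>D\<close> hits \<open>f\<close> has \<open>D f x y\<close> as its
  \<open>(x, y)\<close> entry. For \<open>x \<noteq> y\<close> the linearized triple identity also brings in the opposite corner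
  \<open>f y x\<close>, which contributes nothing to this entry because \<open>D (E y x) x y = 0\<close>.
\<close>

lemma D_entry:
  assumes f: "f \<in> I" and xy: "(x, y) \<in> r"
  shows "D f x y = c x y * f x y - (D (E x x) \<star> f) x y - (f \<star> D (E y y)) x y"
proof -
  note r = refl_r[OF xy]
  show ?thesis
  proof (cases "x = y")
    case True
    have "D (E x x \<star> f \<star> E x x) x x = f x x * c x x"
      using r f by (simp add: compress D_scale closed c_def)
    moreover have "D (E x x \<star> f \<star> E x x) x x = (D (E x x) \<star> f) x x + D f x x + (f \<star> D (E x x)) x x"
      using r f by (subst D_triple) (auto simp: entry_simps)
    ultimately have "(D (E x x) \<star> f) x x + D f x x + (f \<star> D (E x x)) x x = 0"
      using c_diag r by simp
    moreover have "D f x x = ((D (E x x) \<star> f) x x + D f x x + (f \<star> D (E x x)) x x)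
        - (D (E x x) \<star> f) x x - (f \<star> D (E x x)) x x"
      by simp
    ultimately show ?thesis
      using True c_diag r by simp
  next
    case False
    \<comment> \<open>If \<open>y \<le> x\<close> fails then \<open>E y x\<close> lies outside the algebra, but its coefficient vanishes.\<close>
    have swapped: "D (E y y \<star> f \<star> E x x) x y = 0"
    proof (cases "(y, x) \<in> r")
      case True
      then show ?thesis
        using r f xy False D_matrix_unit_transposed_entry
        by (simp add: compress D_scale closed)
    next
      case no: False
      then have "f y x = 0"
        using f by (simp add: incidence_algebra_def)
      then show ?thesis
        using r f D_zero by (simp add: compress scale_pointwise_def)
    qed
    have "D (E x x \<star> f \<star> E y y) x y = f x y * c x y"
      using r f xy by (simp add: compress D_scale closed c_def)
    then have "D (E x x \<star> f \<star> E y y + E y y \<star> f \<star> E x x) x y = f x y * c x y"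
      using swapped r f by (simp add: D_add closed)
    moreover have "D (E x x \<star> f \<star> E y y + E y y \<star> f \<star> E x x) x y =
        (D (E x x) \<star> f) x y + D f x y + (f \<star> D (E y y)) x y"
      using r f False by (subst D_triple_linearized) (auto simp: entry_simps)
    ultimately show ?thesis
      by (simp add: algebra_simps)
  qed
qed

text \<open>
  In \<open>D_entry\<close> the correction terms still depend on \<open>x\<close> and \<open>y\<close> through \<open>E x x\<close> and \<open>E y y\<close>. Only row \<open>x\<close>
  of \<open>D (E x x)\<close> and column \<open>y\<close> of \<open>D (E y y)\<close> enter, and by \<open>column_eq_neg_d\<close> a single function \<open>d\<close>
  carries both.
\<close>

lemma decomposition:
  assumes "f \<in> I"
  shows "D f = (\<lambda>x y. c x y * f x y) - d \<star> f + f \<star> d"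
proof (intro ext)
  fix x y
  show "D f x y = ((\<lambda>x y. c x y * f x y) - d \<star> f + f \<star> d) x y"
  proof (cases "(x, y) \<in> r")
    case True
    have "(D (E x x) \<star> f) x y = (d \<star> f) x y"
      by (simp add: convolution_def d_def)
    moreover have "(f \<star> D (E y y)) x y = - (f \<star> d) x y"
      by (auto simp: convolution_def column_eq_neg_d sum_negf)
    ultimately show ?thesis
      using D_entry[OF assms True] by simp
  next
    case False
    then show ?thesis
      using assms D_closed[OF assms] by (simp add: convolution_def incidence_algebra_def)
  qed
qed

lemma D_product_rule:
  assumes "f \<in> I" "g \<in> I"
  shows "D (f \<star> g) = D f \<star> g + f \<star> D g"
proof -
  let ?H = "\<lambda>f x y. c x y * f x y"
  have "D (f \<star> g) = ?H (f \<star> g) - d \<star> (f \<star> g) + (f \<star> g) \<star> d"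
    using assms by (intro decomposition closed)
  also have "?H (f \<star> g) = ?H f \<star> g + f \<star> ?H g"
    by (rule entrywise_multiplication_product_rule) (rule c_additive)
  also have "?H f \<star> g + f \<star> ?H g - d \<star> (f \<star> g) + (f \<star> g) \<star> d =
      (?H f - d \<star> f + f \<star> d) \<star> g + f \<star> (?H g - d \<star> g + g \<star> d)"
    by (simp only: convolution_distrib convolution_diff assoc) simp
  finally show ?thesis
    using assms by (simp only: decomposition)
qed

end

theorem theorem3p3:
  fixes X :: "'x set" and r :: "'x rel"
    and D :: "('x \<Rightarrow> 'x \<Rightarrow> 'r::{comm_ring, comm_monoid_mult}) \<Rightarrow> ('x \<Rightarrow> 'x \<Rightarrow> 'r)"
  assumes two_torsion_free: "\<And>s::'r. s + s = 0 \<Longrightarrow> s = 0"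
    and preorder: "preorder_on X r"
    and locally_finite: "locally_finite r"
    and jordan: "jordan_derivation scale_pointwise (convolution r) (incidence_algebra r) D"
  shows "derivation scale_pointwise (convolution r) (incidence_algebra r) D"
proof -
  interpret incidence_jordan X r D
    using assms by unfold_locales
  show ?thesis
    using jordan D_product_rule by (simp add: derivation_def jordan_derivation_def)
qed

end
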